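(* Let $n$ be a positive integer, $\Omega\subset\mathbb{C}$ a connected open set with $0\in\Omega$, and $T\in\mathcal{B}_n(\Omega)$. Then the adjoint operator $T^*$ is a (forward) shift on some generalized basis of $\mathcal{H}$.
   Context: $\mathcal{H}$ is a separable, infinite dimensional complex Hilbert space with inner product $(\cdot,\cdot)$, $\mathcal{L}(\mathcal{H})$ is the algebra of bounded linear operators on $\mathcal{H}$, and $\bigvee$ denotes closed linear span. For a connected open set $\Omega\subset\mathbb{C}$ and a positive integer $n$, $\mathcal{B}_n(\Omega)$ is the set of $T\in\mathcal{L}(\mathcal{H})$ such that: (1) $\Omega\subset\sigma(T)$; (2) $\mathrm{ran}(T-z)=\mathcal{H}$ for all $z\in\Omega$; (3) $\bigvee_{z\in\Omega}\ker(T-z)=\mathcal{H}$; (4) $\dim\ker(T-z)=n$ for all $z\in\Omega$. A sequence $\{g_k\}_{k=0}^\infty$ in $\mathcal{H}$ is a generalized basis of $\mathcal{H}$ if there is a sequence $\{f_k\}_{k=0}^\infty$ in $\mathcal{H}$ with $(g_i,f_j)=\delta_{ij}$ for all $i,j\ge 0$ which is total, i.e. $\{x\in\mathcal{H}:(x,f_k)=0\ \forall k\ge 0\}=\{0\}$. An operator $A\in\mathcal{L}(\mathcal{H})$ is a (forward) shift on $\{g_k\}_{k=0}^\infty$ if $Ag_k=g_{k+1}$ for all $k\ge 0$. *)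

theory Defs
  imports "HOL-Analysis.Analysis"
begin

text \<open>
  Complex Hilbert spaces as a type class on top of \<^class>\<open>banach\<close>.  The inner product is linear in
  its first argument and conjugate linear in the second.  Positive definiteness is not a separate
  axiom: it follows from the last one, the norm being nonnegative and definite.
\<close>

class complex_hilbert = banach +
  fixes scaleC :: "complex \<Rightarrow> 'a \<Rightarrow> 'a" (infixr \<open>*\<^sub>C\<close> 75)
    and cinner :: "'a \<Rightarrow> 'a \<Rightarrow> complex"
  assumes scaleC_add_right: "a *\<^sub>C (x + y) = a *\<^sub>C x + a *\<^sub>C y"
    and scaleC_add_left: "(a + b) *\<^sub>C x = a *\<^sub>C x + b *\<^sub>C x"
    and scaleC_scaleC: "a *\<^sub>C (b *\<^sub>C x) = (a * b) *\<^sub>C x"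
    and scaleR_eq_scaleC: "r *\<^sub>R x = complex_of_real r *\<^sub>C x"
    and cinner_commute: "cinner x y = cnj (cinner y x)"
    and cinner_add_left: "cinner (x + y) z = cinner x z + cinner y z"
    and cinner_scaleC_left: "cinner (a *\<^sub>C x) y = a * cinner x y"
    and norm_eq_sqrt_cinner: "norm x = sqrt (Re (cinner x x))"

global_interpretation complex_vector: vector_space "scaleC :: complex \<Rightarrow> 'a \<Rightarrow> 'a::complex_hilbert"
  defines cspan = complex_vector.span
    and cdim = complex_vector.dim
proof
  show "1 *\<^sub>C x = x" for x :: 'a
    using scaleR_eq_scaleC[of 1 x] by simp
qed (simp_all add: scaleC_add_right scaleC_add_left scaleC_scaleC)

definition bounded_clinear :: "('a::complex_hilbert \<Rightarrow> 'a) \<Rightarrow> bool" where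
  "bounded_clinear T \<longleftrightarrow> bounded_linear T \<and> (\<forall>c x. T (c *\<^sub>C x) = c *\<^sub>C T x)"

definition shifted :: "('a::complex_hilbert \<Rightarrow> 'a) \<Rightarrow> complex \<Rightarrow> 'a \<Rightarrow> 'a" where
  "shifted T z = (\<lambda>x. T x - z *\<^sub>C x)"

definition kernel :: "('a::complex_hilbert \<Rightarrow> 'a) \<Rightarrow> 'a set" where
  "kernel T = {x. T x = 0}"

definition spectrum :: "('a::complex_hilbert \<Rightarrow> 'a) \<Rightarrow> complex set" where
  "spectrum T = {z. \<not> (\<exists>S. bounded_clinear S \<and> S \<circ> shifted T z = id \<and> shifted T z \<circ> S = id)}"

text \<open>
  For bounded complex-linear \<open>T\<close> the choice is unique: existence is the Riesz representation theorem.
\<close>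

definition cadjoint :: "('a::complex_hilbert \<Rightarrow> 'a) \<Rightarrow> 'a \<Rightarrow> 'a" where
  "cadjoint T = (SOME S. \<forall>x y. cinner (T x) y = cinner x (S y))"

text \<open>
  \<^const>\<open>cdim\<close> is 0 for infinite-dimensional spaces, so
  the last condition entails finite-dimensionality of the kernels only for \<open>n > 0\<close>.
\<close>

definition cowen_douglas :: "nat \<Rightarrow> complex set \<Rightarrow> ('a::complex_hilbert \<Rightarrow> 'a) set" where
  "cowen_douglas n \<Omega> = {T. bounded_clinear T
     \<and> \<Omega> \<subseteq> spectrum T
     \<and> (\<forall>z\<in>\<Omega>. range (shifted T z) = UNIV)
     \<and> closure (cspan (\<Union>z\<in>\<Omega>. kernel (shifted T z))) = UNIV
     \<and> (\<forall>z\<in>\<Omega>. cdim (kernel (shifted T z)) = n)}"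

definition total_sequence :: "(nat \<Rightarrow> 'a::complex_hilbert) \<Rightarrow> bool" where
  "total_sequence f \<longleftrightarrow> {x. \<forall>k. cinner x (f k) = 0} = {0}"

definition generalized_basis :: "(nat \<Rightarrow> 'a::complex_hilbert) \<Rightarrow> bool" where
  "generalized_basis g \<longleftrightarrow>
     (\<exists>f. (\<forall>i j. cinner (g i) (f j) = (if i = j then 1 else 0)) \<and> total_sequence f)"

definition forward_shift_on :: "('a::complex_hilbert \<Rightarrow> 'a) \<Rightarrow> (nat \<Rightarrow> 'a) \<Rightarrow> bool" where
  "forward_shift_on A g \<longleftrightarrow> bounded_clinear A \<and> (\<forall>k. A (g k) = g (Suc k))"

end

theory Submission
  imports Defs
begin

text \<open>
  Let \<open>S\<close> be the adjoint of \<open>T\<close> and \<open>M\<close> the space of vectors orthogonal to \<open>ker (T ^^ k)\<close> for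
  all \<open>k\<close>. Surjectivity of \<open>T\<close> gives \<open>S M = M\<close>; since all \<open>S - cnj z\<close> with \<open>z \<in> \<Omega>\<close> are bounded
  below, \<open>(S - cnj z) M = M\<close> propagates from \<open>0\<close> to the connected set \<open>\<Omega>\<close>. Hence \<open>M\<close> is orthogonal
  to all eigenvectors of \<open>T\<close> over \<open>\<Omega>\<close>, so \<open>M = 0\<close>: the vectors killed by some power of \<open>T\<close> are dense.

  There is then a chain \<open>T (f 0) = 0\<close>, \<open>T (f (Suc k)) = f k\<close> with dense span: to come close to a
  vector \<open>v\<close> with \<open>(T ^^ N) v = 0\<close>, prolong the chain by \<open>N\<close> steps to end in \<open>w + l v\<close>, where
  \<open>(T ^^ N) w\<close> is the current last element and the scalar \<open>l\<close> is large. After multiplying the formal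
  series \<open>\<Sum>k. f k z^k\<close> by a scalar series one may assume that some \<open>g\<close> satisfies
  \<open>cinner (f k) g = 0\<close> for \<open>k > 0\<close> and \<open>cinner (f 0) g = 1\<close>. Then \<open>(S ^^ k) g\<close> is biorthogonal to \<open>f\<close>.
\<close>

section \<open>Complex Hilbert spaces\<close>

lemma cinner_add_right: "cinner x (y + z) = cinner x y + cinner x (z::'a::complex_hilbert)"
  by (metis cinner_add_left cinner_commute complex_cnj_add)

lemma cinner_scaleC_right: "cinner x (a *\<^sub>C y) = cnj a * cinner x (y::'a::complex_hilbert)"
  by (metis cinner_commute cinner_scaleC_left complex_cnj_mult)

lemma cinner_minus_left: "cinner (- x) y = - cinner x (y::'a::complex_hilbert)"
  using cinner_scaleC_left[of "-1" x y] by simp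

lemma cinner_minus_right: "cinner x (- y) = - cinner x (y::'a::complex_hilbert)"
  using cinner_scaleC_right[of x "-1" y] by simp

lemma cinner_diff_left: "cinner (x - y) z = cinner x z - cinner y (z::'a::complex_hilbert)"
  using cinner_add_left[of x "- y" z] by (simp add: cinner_minus_left)

lemma cinner_diff_right: "cinner x (y - z) = cinner x y - cinner x (z::'a::complex_hilbert)"
  using cinner_add_right[of x y "- z"] by (simp add: cinner_minus_right)

lemma cinner_zero_left [simp]: "cinner 0 (x::'a::complex_hilbert) = 0"
  using cinner_diff_left[of x x x] by simp

lemma cinner_zero_right [simp]: "cinner (x::'a::complex_hilbert) 0 = 0"
  using cinner_diff_right[of x x x] by simp

lemma cinner_sum_left: "cinner (sum f A) (x::'a::complex_hilbert) = (\<Sum>a\<in>A. cinner (f a) x)"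
  by (induction A rule: infinite_finite_induct) (simp_all add: cinner_add_left)

lemma cinner_self: "cinner x x = complex_of_real ((norm (x::'a::complex_hilbert))\<^sup>2)"
proof -
  have "Re (cinner x x) \<ge> 0"
    using norm_ge_zero[of x] unfolding norm_eq_sqrt_cinner by simp
  moreover have "Im (cinner x x) = 0"
    using arg_cong[OF cinner_commute[of x x], of Im] by simp
  ultimately show ?thesis
    by (simp add: complex_eq_iff norm_eq_sqrt_cinner)
qed

lemma cinner_eq_zero_self: "cinner x x = 0 \<longleftrightarrow> x = (0::'a::complex_hilbert)"
  by (simp add: cinner_self)

lemma norm_scaleC: "norm (a *\<^sub>C x) = cmod a * norm (x::'a::complex_hilbert)"
proof -
  have "complex_of_real ((norm (a *\<^sub>C x))\<^sup>2) = a * cnj a * cinner x x"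
    unfolding cinner_self[symmetric] by (simp add: cinner_scaleC_left cinner_scaleC_right)
  also have "\<dots> = complex_of_real ((cmod a * norm x)\<^sup>2)"
    by (simp add: cinner_self complex_norm_square[symmetric] power_mult_distrib)
  finally have "(norm (a *\<^sub>C x))\<^sup>2 = (cmod a * norm x)\<^sup>2"
    using of_real_eq_iff by blast
  then show ?thesis
    by (simp add: power2_eq_iff_nonneg)
qed

text \<open>Pythagoras: removing from \<open>x\<close> its component along \<open>y\<close> leaves a
  residual orthogonal to \<open>y\<close>. This yields Cauchy-Schwarz, and later the orthogonality
  of the residual at a nearest point.\<close>

lemma norm_diff_projection:
  fixes x y :: "'a::complex_hilbert"
  assumes "y \<noteq> 0"
  shows "(norm (x - (cinner x y / cinner y y) *\<^sub>C y))\<^sup>2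
    = (norm x)\<^sup>2 - (cmod (cinner x y))\<^sup>2 / (norm y)\<^sup>2"
proof -
  define t where "t = cinner x y / cinner y y"
  have yy: "cinner y y \<noteq> 0" and t: "t * cinner y y = cinner x y"
    using assms by (simp_all add: cinner_eq_zero_self t_def)
  have "cinner (x - t *\<^sub>C y) y = 0"
    using t by (simp add: cinner_diff_left cinner_scaleC_left)
  then have "cinner (x - t *\<^sub>C y) (x - t *\<^sub>C y) = cinner (x - t *\<^sub>C y) x"
    by (simp add: cinner_diff_right cinner_scaleC_right)
  also have "\<dots> = cinner x x - cinner x y * cnj (cinner x y) / cinner y y"
    by (simp add: cinner_diff_left cinner_scaleC_left t_def flip: cinner_commute)
  also have "\<dots> = complex_of_real ((norm x)\<^sup>2 - (cmod (cinner x y))\<^sup>2 / (norm y)\<^sup>2)"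
    by (simp add: cinner_self complex_norm_square[symmetric])
  finally show ?thesis
    unfolding cinner_self t_def using of_real_eq_iff by blast
qed

lemma cinner_Cauchy_Schwarz: "cmod (cinner x y) \<le> norm x * norm (y::'a::complex_hilbert)"
proof (cases "y = 0")
  case False
  then have "(cmod (cinner x y))\<^sup>2 / (norm y)\<^sup>2 \<le> (norm x)\<^sup>2"
    using norm_diff_projection[OF False, of x]
      zero_le_power2[of "norm (x - (cinner x y / cinner y y) *\<^sub>C y)"] by linarith
  then have "(cmod (cinner x y))\<^sup>2 \<le> (norm x * norm y)\<^sup>2"
    using False by (simp add: divide_le_eq power_mult_distrib)
  then show ?thesis
    by (rule power2_le_imp_le) simp
qed simp

lemma bounded_linear_cinner_left: "bounded_linear (\<lambda>x. cinner x (y::'a::complex_hilbert))"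
  by (rule bounded_linear_intro[where K = "norm y"])
    (simp_all add: cinner_add_left scaleR_eq_scaleC cinner_scaleC_left scaleR_conv_of_real
      cinner_Cauchy_Schwarz)

lemma bounded_linear_cinner_right: "bounded_linear (\<lambda>y. cinner (x::'a::complex_hilbert) y)"
  by (rule bounded_linear_intro[where K = "norm x"])
    (simp_all add: cinner_add_right scaleR_eq_scaleC cinner_scaleC_right scaleR_conv_of_real
      cinner_Cauchy_Schwarz[of x, unfolded mult.commute[of "norm x"]])

lemmas continuous_on_cinner_left [continuous_intros] =
  bounded_linear.continuous_on[OF bounded_linear_cinner_left]

lemmas continuous_on_cinner_right [continuous_intros] =
  bounded_linear.continuous_on[OF bounded_linear_cinner_right]

lemma complex_parallelogram_law:
  "(norm (x + y))\<^sup>2 + (norm (x - y))\<^sup>2 = 2 * (norm x)\<^sup>2 + 2 * (norm (y::'a::complex_hilbert))\<^sup>2"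
proof -
  have "complex_of_real ((norm (x + y))\<^sup>2 + (norm (x - y))\<^sup>2)
      = complex_of_real (2 * (norm x)\<^sup>2 + 2 * (norm y)\<^sup>2)"
    unfolding of_real_add of_real_mult cinner_self[symmetric]
    by (simp add: cinner_add_left cinner_add_right cinner_diff_left cinner_diff_right)
  then show ?thesis
    using of_real_eq_iff by blast
qed

section \<open>Orthogonal projection, Riesz representation and the adjoint\<close>

definition closed_csubspace :: "'a::complex_hilbert set \<Rightarrow> bool" where
  "closed_csubspace M \<longleftrightarrow> closed M \<and> complex_vector.subspace M"

lemma closed_csubspaceD:
  assumes "closed_csubspace M"
  shows "closed M" "0 \<in> M" "x \<in> M \<Longrightarrow> y \<in> M \<Longrightarrow> x + y \<in> M" "x \<in> M \<Longrightarrow> y \<in> M \<Longrightarrow> x - y \<in> M"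
    "x \<in> M \<Longrightarrow> a *\<^sub>C x \<in> M"
  using assms unfolding closed_csubspace_def
  by (auto intro: complex_vector.subspace_0 complex_vector.subspace_add
      complex_vector.subspace_diff complex_vector.subspace_scale)

text \<open>A minimising sequence for the distance from \<open>x\<close> to \<open>M\<close> is
  Cauchy by the parallelogram law; its limit is the projection.\<close>

lemma orthogonal_projection:
  fixes M :: "'a::complex_hilbert set"
  assumes M: "closed_csubspace M"
  obtains m where "m \<in> M" "\<And>v. v \<in> M \<Longrightarrow> cinner (x - m) v = 0"
proof -
  define d where "d = (INF m\<in>M. (norm (x - m))\<^sup>2)"
  have bdd: "bdd_below ((\<lambda>m. (norm (x - m))\<^sup>2) ` M)"
    by (rule bdd_belowI2[where m = 0]) simp
  have d_le: "d \<le> (norm (x - m))\<^sup>2" if "m \<in> M" for m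
    unfolding d_def using bdd that by (rule cINF_lower)
  have "\<exists>m\<in>M. (norm (x - m))\<^sup>2 < d + inverse (real (Suc n))" for n
  proof -
    have "M \<noteq> {}" using closed_csubspaceD(2)[OF M] by blast
    moreover have "d < d + inverse (real (Suc n))" by simp
    ultimately show ?thesis
      unfolding d_def using cINF_less_iff[OF _ bdd] by blast
  qed
  then obtain s where sM: "s n \<in> M" and s: "(norm (x - s n))\<^sup>2 < d + inverse (real (Suc n))" for n
    by metis
  have close: "(norm (s i - s j))\<^sup>2 \<le> 2 * inverse (real (Suc i)) + 2 * inverse (real (Suc j))" for i j
  proof -
    \<comment> \<open>The midpoint \<open>p\<close> lies in \<open>M\<close>, so its squared
      distance to \<open>x\<close> is at least \<open>d\<close>; this bounds the sum term of the
      parallelogram law from below.\<close>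
    define p where "p = (1/2) *\<^sub>C (s i + s j)"
    have "p \<in> M" unfolding p_def by (intro closed_csubspaceD[OF M] sM)
    have "(x - s j) + (x - s i) = 2 *\<^sub>C (x - p)"
      unfolding p_def complex_vector.scale_right_diff_distrib
      by (simp, metis scaleC_add_left one_add_one complex_vector.scale_one add_diff_add)
    then have "(norm ((x - s j) + (x - s i)))\<^sup>2 = 4 * (norm (x - p))\<^sup>2"
      by (simp add: norm_scaleC power_mult_distrib)
    then show ?thesis
      using complex_parallelogram_law[of "x - s j" "x - s i"] d_le[OF \<open>p \<in> M\<close>] s[of i] s[of j]
      by simp
  qed
  have "Cauchy s"
  proof (rule metric_CauchyI)
    fix e :: real assume "e > 0"
    then obtain N where N: "inverse (real (Suc N)) < e\<^sup>2 / 4"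
      using reals_Archimedean[of "e\<^sup>2 / 4"] by auto
    have "dist (s i) (s j) < e" if "i \<ge> N" "j \<ge> N" for i j
    proof -
      have "inverse (real (Suc i)) \<le> inverse (real (Suc N))"
        "inverse (real (Suc j)) \<le> inverse (real (Suc N))"
        using that by (simp_all add: le_imp_inverse_le)
      then have "(norm (s i - s j))\<^sup>2 < e\<^sup>2"
        using close[of i j] N by linarith
      then show ?thesis
        using \<open>e > 0\<close> by (simp add: dist_norm power_less_imp_less_base)
    qed
    then show "\<exists>N. \<forall>i\<ge>N. \<forall>j\<ge>N. dist (s i) (s j) < e" by blast
  qed
  then obtain m where lim: "s \<longlonglongrightarrow> m"
    using Cauchy_convergent convergent_def by blast
  have mM: "m \<in> M"
    using closed_csubspaceD(1)[OF M] sM lim by (auto intro: closed_sequentially)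
  have "(\<lambda>n. (norm (x - s n))\<^sup>2) \<longlonglongrightarrow> (norm (x - m))\<^sup>2"
    by (intro tendsto_intros lim)
  moreover have "(\<lambda>n. d + inverse (real (Suc n))) \<longlonglongrightarrow> d + 0"
    by (intro tendsto_intros LIMSEQ_inverse_real_of_nat)
  ultimately have le_d: "(norm (x - m))\<^sup>2 \<le> d"
    using s by (intro LIMSEQ_le[of _ _ _ d]) (auto intro: less_imp_le)
  have "cinner (x - m) v = 0" if "v \<in> M" for v
  proof (cases "v = 0")
    case False
    \<comment> \<open>Moving \<open>m\<close> by the component of \<open>x - m\<close> along
      \<open>v\<close> stays in \<open>M\<close> and would come strictly closer to \<open>x\<close>
      unless that component is 0.\<close>
    let ?w = "(cinner (x - m) v / cinner v v) *\<^sub>C v"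
    have "m + ?w \<in> M" by (intro closed_csubspaceD[OF M] mM that)
    then have "(norm (x - m))\<^sup>2 \<le> (norm (x - m - ?w))\<^sup>2"
      using d_le[of "m + ?w"] le_d unfolding diff_diff_eq by linarith
    then show ?thesis
      unfolding norm_diff_projection[OF False] using False
      by (simp add: divide_le_0_iff)
  qed simp
  with mM show ?thesis using that by blast
qed

text \<open>The residual \<open>r\<close> of a vector outside the kernel of \<open>\<phi>\<close> is
  orthogonal to that kernel, and every \<open>y\<close> is a multiple of \<open>r\<close> plus an
  element of the kernel. So \<open>\<phi>\<close> is pairing with a suitable multiple of
  \<open>r\<close>.\<close>

theorem Riesz_representation:
  fixes \<phi> :: "'a::complex_hilbert \<Rightarrow> complex"
  assumes bl: "bounded_linear \<phi>" and hom: "\<And>a x. \<phi> (a *\<^sub>C x) = a * \<phi> x"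
  obtains u where "\<And>y. \<phi> y = cinner y u"
proof (cases "\<forall>x. \<phi> x = 0")
  case True
  then show ?thesis using that[of 0] by simp
next
  case False
  interpret bounded_linear \<phi> by (rule bl)
  from False obtain x where x: "\<phi> x \<noteq> 0" by blast
  have M: "closed_csubspace {y. \<phi> y = 0}"
    unfolding closed_csubspace_def complex_vector.subspace_def
    by (auto simp: hom add zero intro!: closed_Collect_eq continuous_on continuous_on_id)
  obtain m where m: "\<phi> m = 0" "\<And>v. \<phi> v = 0 \<Longrightarrow> cinner (x - m) v = 0"
    using orthogonal_projection[OF M, of x] by auto
  define r where "r = x - m"
  have r: "\<phi> r = \<phi> x" using m(1) by (simp add: r_def diff)
  then have "r \<noteq> 0" using x zero by auto
  have "\<phi> y = cinner y ((cnj (\<phi> r) / cinner r r) *\<^sub>C r)" for y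
  proof -
    have "\<phi> (y - (\<phi> y / \<phi> r) *\<^sub>C r) = 0" using x r by (simp add: diff hom)
    then have "cinner r (y - (\<phi> y / \<phi> r) *\<^sub>C r) = 0" using m(2) r_def by blast
    then have "cinner (y - (\<phi> y / \<phi> r) *\<^sub>C r) r = 0" by (metis cinner_commute complex_cnj_zero)
    then have "cinner y r = \<phi> y / \<phi> r * cinner r r"
      by (simp add: cinner_diff_left cinner_scaleC_left)
    then show ?thesis
      using x r \<open>r \<noteq> 0\<close> by (simp add: cinner_scaleC_right cinner_self)
  qed
  then show ?thesis using that by blast
qed

lemma bounded_clinearD:
  assumes "bounded_clinear T"
  shows "bounded_linear T" "T (a *\<^sub>C x) = a *\<^sub>C T x"
    "T (x + y) = T x + T y" "T (x - y) = T x - T y" "T 0 = 0"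
  using assms linear_simps[of T] unfolding bounded_clinear_def by auto

text \<open>Riesz representation of \<open>x \<mapsto> cinner (T x) y\<close>, for each
  \<open>y\<close>, shows that the choice defining \<open>cadjoint\<close> has a witness.\<close>

lemma cadjoint:
  assumes T: "bounded_clinear T"
  shows "cinner (T x) y = cinner x (cadjoint T y)"
proof -
  have "\<exists>u. \<forall>x. cinner (T x) y = cinner x u" for y
  proof -
    have "bounded_linear (\<lambda>x. cinner (T x) y)"
      by (rule bounded_linear_compose[OF bounded_linear_cinner_left bounded_clinearD(1)[OF T]])
    then show ?thesis
      using Riesz_representation[of "\<lambda>x. cinner (T x) y"]
      by (metis bounded_clinearD(2)[OF T] cinner_scaleC_left)
  qed
  then have "\<exists>S. \<forall>x y. cinner (T x) y = cinner x (S y)"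
    by metis
  then show ?thesis
    unfolding cadjoint_def by (rule someI2_ex) blast
qed

lemma cinner_eqI: "(\<And>x. cinner x y = cinner x z) \<Longrightarrow> y = (z::'a::complex_hilbert)"
  by (metis cinner_diff_right cinner_eq_zero_self diff_self eq_iff_diff_eq_0)

text \<open>A bound \<open>K\<close> for \<open>T\<close> also serves for the adjoint
  \<open>S\<close>: the square of \<open>norm (S y)\<close> is \<open>cinner (T (S y)) y\<close>, at
  most \<open>norm (S y) * K * norm y\<close>.\<close>

lemma bounded_clinear_cadjoint:
  assumes T: "bounded_clinear T"
  shows "bounded_clinear (cadjoint T)"
proof -
  let ?S = "cadjoint T"
  have add: "?S (x + y) = ?S x + ?S y" for x y
    by (rule cinner_eqI) (simp add: cinner_add_right flip: cadjoint[OF T])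
  have scale: "?S (a *\<^sub>C x) = a *\<^sub>C ?S x" for a x
    by (rule cinner_eqI) (simp add: cinner_scaleC_right flip: cadjoint[OF T])
  obtain K where K: "\<And>x. norm (T x) \<le> norm x * K"
    using bounded_linear.bounded[OF bounded_clinearD(1)[OF T]] by blast
  have "norm (?S y) \<le> norm y * K" for y
  proof (cases "?S y = 0")
    case True
    then show ?thesis
      using K[of y] by (metis norm_ge_zero norm_zero order_trans)
  next
    case False
    have "complex_of_real ((norm (?S y))\<^sup>2) = cinner (T (?S y)) y"
      by (simp add: cadjoint[OF T] cinner_self)
    then have "(norm (?S y))\<^sup>2 = cmod (cinner (T (?S y)) y)"
      by (metis norm_of_real abs_power2)
    also have "\<dots> \<le> norm (?S y) * K * norm y"
      by (meson K cinner_Cauchy_Schwarz mult_right_mono norm_ge_zero order_trans)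
    finally show ?thesis
      using False by (simp add: power2_eq_square mult_ac)
  qed
  then show ?thesis
    unfolding bounded_clinear_def
    by (auto simp: add scale scaleR_eq_scaleC intro!: bounded_linear_intro[where K = K])
qed

section \<open>Adjoints of surjective operators\<close>

lemma cinner_eq_zero_commute: "cinner x y = 0 \<longleftrightarrow> cinner y (x::'a::complex_hilbert) = 0"
  by (metis cinner_commute complex_cnj_zero)

text \<open>
  The functionals \<open>v \<mapsto> cinner v y\<close> with \<open>norm (S y) \<le> 1\<close> are pointwise bounded
  because every \<open>v\<close> is some \<open>T x\<close>, so uniform boundedness applies.
\<close>

lemma adjoint_bounded_below:
  fixes T S :: "'a::complex_hilbert \<Rightarrow> 'a"
  assumes surj: "range T = UNIV"
    and S: "bounded_clinear S"
    and adj: "\<And>x y. cinner (T x) y = cinner x (S y)"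
  obtains c where "c > 0" "\<And>y. c * norm y \<le> norm (S y)"
proof -
  define F where "F n = {v. \<forall>y. norm (S y) \<le> 1 \<longrightarrow> cmod (cinner v y) \<le> real n}" for n :: nat
  have closed: "closed (F n)" for n
    unfolding F_def
    by (intro closed_Collect_all closed_Collect_imp open_Collect_const closed_Collect_le
        continuous_intros)
  have cover: "\<exists>n. v \<in> F n" for v
  proof -
    obtain x where x: "v = T x" using surj by (metis UNIV_I image_iff)
    obtain n :: nat where "norm x \<le> real n" using real_arch_simple by blast
    have "cmod (cinner v y) \<le> real n" if "norm (S y) \<le> 1" for y
    proof -
      have "cmod (cinner v y) \<le> norm x * norm (S y)"
        unfolding x adj by (rule cinner_Cauchy_Schwarz)
      also have "\<dots> \<le> norm x" using that by (simp add: mult_left_le)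
      finally show ?thesis using \<open>norm x \<le> real n\<close> by simp
    qed
    then show ?thesis unfolding F_def by blast
  qed
  \<comment> \<open>Baire category: countably many closed sets \<open>F n\<close> cover the complete
    space.\<close>
  have "\<exists>n. interior (F n) \<noteq> {}"
  proof (rule ccontr)
    assume "\<not> ?thesis"
    then have "euclidean interior_of \<Union>(range F) = {}"
      using closed by (intro Baire_category_alt disjI1 completely_metrizable_space_euclidean) auto
    moreover have "\<Union>(range F) = UNIV" using cover by auto
    ultimately show False by simp
  qed
  then obtain n v r where r: "r > 0" and ball: "cball v r \<subseteq> F n"
    by (meson all_not_in_conv mem_interior_cball)
  have bound: "r * norm y \<le> 2 * real n" if "norm (S y) \<le> 1" for y
  proof (cases "y = 0")
    case False
    \<comment> \<open>\<open>w\<close> is \<open>y\<close> rescaled to length \<open>r\<close>, so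
      that \<open>v\<close> and \<open>v + w\<close> both lie in the ball; the difference of their
      pairings with \<open>y\<close> is \<open>r * norm y\<close>.\<close>
    define w where "w = complex_of_real (r / norm y) *\<^sub>C y"
    have "v \<in> F n" "v + w \<in> F n"
      using r False by (auto intro!: subsetD[OF ball] simp: dist_norm w_def norm_scaleC norm_divide)
    then have le: "cmod (cinner v y) \<le> real n" "cmod (cinner (v + w) y) \<le> real n"
      using that by (auto simp: F_def)
    have "cinner w y = complex_of_real (r * norm y)"
      using False by (simp add: w_def cinner_scaleC_left cinner_self power2_eq_square)
    then have "r * norm y = cmod (cinner (v + w) y - cinner v y)"
      using r by (simp add: cinner_add_left norm_mult)
    also have "\<dots> \<le> 2 * real n"
      using norm_triangle_ineq4[of "cinner (v + w) y" "cinner v y"] le by linarith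
    finally show ?thesis .
  qed simp
  \<comment> \<open>The summand 1 keeps the denominator positive when \<open>n = 0\<close>.\<close>
  define c where "c = r / (2 * real n + 1)"
  have "c * norm y \<le> norm (S y)" for y
  proof (cases "S y = 0")
    case True
    have "y = 0"
    proof (rule cinner_eqI)
      fix x
      obtain u where "x = T u" using surj by (metis UNIV_I image_iff)
      then show "cinner x y = cinner x 0" by (simp add: adj True)
    qed
    then show ?thesis by simp
  next
    case False
    let ?a = "complex_of_real (1 / norm (S y))"
    have "norm (S (?a *\<^sub>C y)) \<le> 1"
      using False by (simp add: bounded_clinearD(2)[OF S] norm_scaleC norm_divide)
    from bound[OF this] have "r * norm y \<le> 2 * real n * norm (S y)"
      using False by (simp add: norm_scaleC norm_divide field_simps)
    also have "\<dots> \<le> (2 * real n + 1) * norm (S y)"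
      by (simp add: mult_right_mono)
    finally show ?thesis
      by (simp add: c_def field_simps)
  qed
  moreover have "c > 0" using r by (simp add: c_def add_nonneg_pos)
  ultimately show ?thesis using that by blast
qed

text \<open>The lower bound makes preimages of a Cauchy sequence Cauchy, so the range is
  complete.\<close>

lemma closed_range_bounded_below:
  fixes S :: "'a::complex_hilbert \<Rightarrow> 'a"
  assumes S: "bounded_clinear S" and c: "c > 0" "\<And>y. c * norm y \<le> norm (S y)"
  shows "closed_csubspace (range S)"
  unfolding closed_csubspace_def
proof
  have "complete (S ` UNIV)"
    by (rule complete_isometric_image[OF c(1) subspace_UNIV bounded_clinearD(1)[OF S]])
      (use c(2) in \<open>simp_all add: complete_UNIV\<close>)
  then show "closed (range S)" by (rule complete_imp_closed)
  show "complex_vector.subspace (range S)"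
    unfolding complex_vector.subspace_def
    by (metis (no_types, lifting) bounded_clinearD(2,3,5)[OF S] rangeE rangeI)
qed

text \<open>One half of the closed range theorem. The residual of \<open>x\<close> after projection
  to the range of \<open>S\<close> lies in the kernel of \<open>T\<close>; being orthogonal to
  \<open>x\<close> and to the range of \<open>S\<close>, it is orthogonal to itself.\<close>

lemma orthogonal_kernel_imp_range_adjoint:
  fixes T S :: "'a::complex_hilbert \<Rightarrow> 'a"
  assumes T: "bounded_clinear T" and surj: "range T = UNIV" and S: "bounded_clinear S"
    and adj: "\<And>x y. cinner (T x) y = cinner x (S y)"
    and x: "\<And>v. T v = 0 \<Longrightarrow> cinner x v = 0"
  shows "x \<in> range S"
proof -
  obtain c where "c > 0" "\<And>y. c * norm y \<le> norm (S y)"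
    using adjoint_bounded_below[OF surj S adj] by blast
  then have "closed_csubspace (range S)"
    using closed_range_bounded_below[OF S] by blast
  then obtain u where u: "\<And>v. v \<in> range S \<Longrightarrow> cinner (x - S u) v = 0"
    using orthogonal_projection[of "range S" x] by blast
  have "cinner (T (x - S u)) y = 0" for y
    using u[of "S y"] by (simp add: adj)
  then have ker: "T (x - S u) = 0"
    using cinner_eq_zero_self by blast
  then have "cinner (x - S u) (S u) = 0"
    by (metis adj cinner_zero_left)
  moreover have "cinner (x - S u) x = 0"
    using x[OF ker] cinner_eq_zero_commute by blast
  ultimately have "cinner (x - S u) (x - S u) = 0"
    by (simp add: cinner_diff_right)
  then show ?thesis
    by (simp add: cinner_eq_zero_self)
qed

section \<open>Propagation of invariance along a connected set of parameters\<close>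

text \<open>The equation \<open>(S - z) u = m\<close> reads
  \<open>(S - w) u = m + (z - w) u\<close>. Inverting \<open>S - w\<close> on \<open>M\<close> turns
  it into a fixed point problem, a contraction with ratio \<open>cmod (z - w) / c\<close>.\<close>

lemma shifted_image_perturb:
  fixes S :: "'a::complex_hilbert \<Rightarrow> 'a"
  assumes M: "closed_csubspace M" and S: "bounded_clinear S"
    and below: "\<And>y. c * norm y \<le> norm (shifted S w y)"
    and image: "shifted S w ` M = M" and z: "cmod (z - w) < c"
  shows "shifted S z ` M = M"
proof
  have shift: "shifted S z u = shifted S w u - (z - w) *\<^sub>C u" for u
    by (simp add: shifted_def complex_vector.scale_left_diff_distrib)
  have "c > 0" using z norm_ge_zero[of "z - w"] by linarith
  show "shifted S z ` M \<subseteq> M"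
  proof clarify
    fix u assume "u \<in> M"
    moreover have "shifted S w u \<in> M" using image \<open>u \<in> M\<close> by blast
    ultimately show "shifted S z u \<in> M"
      unfolding shift by (intro closed_csubspaceD[OF M])
  qed
  show "M \<subseteq> shifted S z ` M"
  proof
    fix m assume m: "m \<in> M"
    define R where "R = inv_into M (shifted S w)"
    have R: "R y \<in> M" "shifted S w (R y) = y" if "y \<in> M" for y
      using that inv_into_into[of y "shifted S w" M] f_inv_into_f[of y "shifted S w" M]
      unfolding image R_def by simp_all
    define f where "f u = R (m + (z - w) *\<^sub>C u)" for u
    have arg: "m + (z - w) *\<^sub>C u \<in> M" if "u \<in> M" for u
      using that m by (intro closed_csubspaceD[OF M])
    have lip: "dist (f u) (f v) \<le> cmod (z - w) / c * dist u v" if "u \<in> M" "v \<in> M" for u v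
    proof -
      have "shifted S w (f u - f v) = shifted S w (f u) - shifted S w (f v)"
        by (simp add: shifted_def bounded_clinearD(4)[OF S]
            complex_vector.scale_right_diff_distrib)
      also have "\<dots> = (z - w) *\<^sub>C (u - v)"
        using R arg that by (simp add: f_def complex_vector.scale_right_diff_distrib)
      finally have "c * norm (f u - f v) \<le> cmod (z - w) * norm (u - v)"
        using below[of "f u - f v"] by (simp add: norm_scaleC)
      then show ?thesis
        using \<open>c > 0\<close> by (simp add: dist_norm field_simps)
    qed
    have "\<exists>!u\<in>M. f u = u"
    proof (rule Banach_fix)
      show "complete M" using closed_csubspaceD(1)[OF M] by (simp add: complete_eq_closed)
      show "M \<noteq> {}" using m by blast
      show "f ` M \<subseteq> M" using R arg by (auto simp: f_def)
      show "0 \<le> cmod (z - w) / c" "cmod (z - w) / c < 1" using \<open>c > 0\<close> z by simp_all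
    qed (rule lip)
    then obtain u where u: "u \<in> M" "f u = u" by blast
    then have "shifted S w u = m + (z - w) *\<^sub>C u"
      using R[OF arg[OF u(1)]] by (simp add: f_def)
    then have "shifted S z u = m" by (simp add: shift)
    then show "m \<in> shifted S z ` M" using u(1) by blast
  qed
qed

text \<open>Every point of \<Omega> has a neighbourhood in which the equality passes from any point
  to any other, so connectedness carries it from \<open>a\<close> to \<open>b\<close>.\<close>

lemma shifted_image_connected:
  fixes S :: "'a::complex_hilbert \<Rightarrow> 'a"
  assumes M: "closed_csubspace M" and S: "bounded_clinear S" and "connected \<Omega>"
    and below: "\<And>z. z \<in> \<Omega> \<Longrightarrow> \<exists>c>0. \<forall>y. c * norm y \<le> norm (shifted S z y)"
    and "a \<in> \<Omega>" "b \<in> \<Omega>" "shifted S a ` M = M"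
  shows "shifted S b ` M = M"
proof (rule connected_induction_simple[where P = "\<lambda>z. shifted S z ` M = M", OF assms(3,5,6,7)])
  fix z assume "z \<in> \<Omega>"
  then obtain c where c: "c > 0" "\<And>y. c * norm y \<le> norm (shifted S z y)"
    using below by blast
  show "\<exists>N. openin (top_of_set \<Omega>) N \<and> z \<in> N \<and>
      (\<forall>w\<in>N. \<forall>w'\<in>N. shifted S w ` M = M \<longrightarrow> shifted S w' ` M = M)"
  proof (intro exI conjI ballI impI)
    \<comment> \<open>Radius \<open>c / 3\<close>: within this ball the lower bound drops from
      \<open>c\<close> to no less than \<open>2 * c / 3\<close>, while two of its points are less
      than \<open>2 * c / 3\<close> apart.\<close>
    show "openin (top_of_set \<Omega>) (\<Omega> \<inter> ball z (c / 3))" by (simp add: openin_open_Int)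
    show "z \<in> \<Omega> \<inter> ball z (c / 3)" using \<open>z \<in> \<Omega>\<close> c(1) by simp
    fix w w' assume w: "w \<in> \<Omega> \<inter> ball z (c / 3)" "w' \<in> \<Omega> \<inter> ball z (c / 3)"
      and image: "shifted S w ` M = M"
    have below_w: "(2 * c / 3) * norm y \<le> norm (shifted S w y)" for y
    proof -
      have "shifted S w y = shifted S z y - (w - z) *\<^sub>C y"
        by (simp add: shifted_def complex_vector.scale_left_diff_distrib)
      then have "norm (shifted S z y) \<le> norm (shifted S w y) + cmod (w - z) * norm y"
        using norm_triangle_ineq[of "shifted S w y" "(w - z) *\<^sub>C y"] by (simp add: norm_scaleC)
      moreover have "cmod (w - z) * norm y \<le> (c / 3) * norm y"
        using w(1) by (intro mult_right_mono) (simp_all add: dist_norm norm_minus_commute)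
      ultimately show ?thesis using c(2)[of y] by (simp add: field_simps)
    qed
    have "cmod (w' - w) < 2 * c / 3"
      using w dist_triangle2[of w' w z] by (simp add: dist_norm norm_minus_commute)
    then show "shifted S w' ` M = M"
      by (rule shifted_image_perturb[OF M S below_w image])
  qed
qed

text \<open>\<open>T\<close> maps the kernel of \<open>T ^^ Suc k\<close> into that of
  \<open>T ^^ k\<close>, which gives \<open>S M \<subseteq> M\<close>, and by surjectivity onto it,
  which gives the converse: a vector of \<open>M\<close> is some \<open>S u\<close>, being
  orthogonal to the kernel of \<open>T\<close>, and then \<open>u\<close> is in \<open>M\<close>
  too.\<close>

lemma orthogonal_root_kernels_invariant:
  fixes T S :: "'a::complex_hilbert \<Rightarrow> 'a"
  assumes T: "bounded_clinear T" and surj: "range T = UNIV" and S: "bounded_clinear S"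
    and adj: "\<And>x y. cinner (T x) y = cinner x (S y)"
  defines "M \<equiv> {x. \<forall>k v. (T ^^ k) v = 0 \<longrightarrow> cinner x v = 0}"
  shows "closed_csubspace M" "S ` M = M"
proof -
  have adj': "cinner (S y) x = cinner y (T x)" for x y
    by (metis adj cinner_commute)
  show "closed_csubspace M"
    unfolding closed_csubspace_def complex_vector.subspace_def M_def
    by (auto simp: cinner_add_left cinner_scaleC_left intro!: closed_Collect_all closed_Collect_imp
        closed_Collect_eq continuous_intros)
  show "S ` M = M"
  proof
    show "S ` M \<subseteq> M"
    proof clarify
      fix x assume x: "x \<in> M"
      have "cinner x (T v) = 0" if "(T ^^ k) v = 0" for k v
      proof (cases k)
        case 0
        then show ?thesis using that by (simp add: bounded_clinearD(5)[OF T])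
      next
        case (Suc j)
        then have "(T ^^ j) (T v) = 0" using that by (simp add: funpow_swap1)
        then show ?thesis using x unfolding M_def by blast
      qed
      then show "S x \<in> M" by (simp add: M_def adj')
    qed
    show "M \<subseteq> S ` M"
    proof
      fix x assume x: "x \<in> M"
      have "cinner x v = 0" if "T v = 0" for v
      proof -
        have "(T ^^ 1) v = 0" using that by simp
        then show ?thesis using x unfolding M_def by blast
      qed
      then obtain u where u: "x = S u"
        using orthogonal_kernel_imp_range_adjoint[OF T surj S adj] by blast
      have "cinner u v = 0" if "(T ^^ k) v = 0" for k v
      proof -
        obtain w where w: "v = T w" using surj by (metis UNIV_I image_iff)
        then have "(T ^^ Suc k) w = 0" using that by (simp add: funpow_swap1)
        then have "cinner x w = 0" using x unfolding M_def by blast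
        then show ?thesis by (simp add: u w adj')
      qed
      then show "x \<in> S ` M" by (auto simp: M_def u)
    qed
  qed
qed

section \<open>Backward chains\<close>

lemma surj_funpow_range:
  assumes "range (T :: 'a \<Rightarrow> 'a) = UNIV"
  shows "\<exists>w. (T ^^ k) w = v"
  using surj_fn[OF assms, of k] by (metis surjD)

lemma bounded_clinear_funpow:
  assumes "bounded_clinear T"
  shows "(T ^^ k) (x + y) = (T ^^ k) x + (T ^^ k) y" "(T ^^ k) (a *\<^sub>C x) = a *\<^sub>C (T ^^ k) x"
    "(T ^^ k) 0 = 0"
  by (induction k) (simp_all add: bounded_clinearD[OF assms])

lemma funpow_zero_mono:
  assumes "bounded_clinear T" "(T ^^ k) v = 0" "k \<le> l"
  shows "(T ^^ l) v = 0"
proof -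
  have "(T ^^ l) v = (T ^^ (l - k)) ((T ^^ k) v)"
    using assms(3) funpow_add[of "l - k" k T] by simp
  then show ?thesis using assms(2) by (simp add: bounded_clinear_funpow(3)[OF assms(1)])
qed

text \<open>Adding a multiple of \<open>v\<close> to a preimage \<open>w\<close> of \<open>h\<close>
  does not change its image under \<open>T ^^ N\<close>. With a large factor \<open>l\<close>,
  rescaling by \<open>1 / l\<close> leaves \<open>v\<close> plus the small error
  \<open>w / l\<close>.\<close>

lemma root_vector_lift_approx:
  assumes T: "bounded_clinear T" and surj: "range T = UNIV"
    and v: "(T ^^ N) v = 0" and "e > 0"
  obtains h' a where "(T ^^ N) h' = h" "dist (a *\<^sub>C h') v < e"
proof -
  obtain w where w: "(T ^^ N) w = h" using surj_funpow_range[OF surj] by blast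
  obtain l :: real where l: "l > norm w / e" "l > 0"
    by (metis gt_ex max_less_iff_conj)
  define h' where "h' = w + complex_of_real l *\<^sub>C v"
  define a where "a = complex_of_real (1 / l)"
  have lift: "(T ^^ N) h' = h"
    by (simp add: h'_def bounded_clinear_funpow[OF T] v w)
  have "a *\<^sub>C h' - v = a *\<^sub>C w"
    using l(2) by (simp add: h'_def a_def scaleC_add_right)
  then have "dist (a *\<^sub>C h') v = norm w / l"
    using l(2) by (simp add: dist_norm norm_scaleC norm_divide a_def)
  moreover have "norm w / l < e"
    using l \<open>e > 0\<close> by (simp add: field_simps)
  ultimately show ?thesis using that[OF lift, of a] by simp
qed

text \<open>Dependent choice, with \<open>v j\<close> treated at stage \<open>j\<close>. A pair
  \<open>(h, m)\<close> records that \<open>h\<close> is to be the entry of the chain at index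
  \<open>m\<close>; the entries in between are images of later ones under powers of
  \<open>T\<close>.\<close>

lemma backward_chain_approximating:
  fixes T :: "'a::complex_hilbert \<Rightarrow> 'a"
  assumes T: "bounded_clinear T" and surj: "range T = UNIV"
    and v: "\<And>j. \<exists>N. (T ^^ N) (v j) = 0"
  obtains f where "f 0 = e0" "\<And>k. T (f (Suc k)) = f k"
    "\<And>j. \<exists>k a. dist (a *\<^sub>C f k) (v j) < inverse (real (Suc j))"
proof -
  define P where "P j p \<longleftrightarrow> j \<le> snd p \<and> (j = 0 \<longrightarrow> p = (e0, 0))" for j and p :: "'a \<times> nat"
  define Q where "Q j p q \<longleftrightarrow> snd p < snd q \<and> (T ^^ (snd q - snd p)) (fst q) = fst p
      \<and> (\<exists>a. dist (a *\<^sub>C fst q) (v j) < inverse (real (Suc j)))" for j and p q :: "'a \<times> nat"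
  have "\<exists>s. \<forall>j. P j (s j) \<and> Q j (s j) (s (Suc j))"
  proof (rule dependent_nat_choice)
    show "\<exists>p. P 0 p" by (simp add: P_def)
  next
    fix p :: "'a \<times> nat" and j :: nat
    assume p: "P j p"
    obtain N where "(T ^^ N) (v j) = 0" using v by blast
    \<comment> \<open>\<open>Suc N\<close> instead of \<open>N\<close> makes the index grow strictly
      even if \<open>N = 0\<close>.\<close>
    then have N: "(T ^^ Suc N) (v j) = 0" by (rule funpow_zero_mono[OF T]) simp
    have "inverse (real (Suc j)) > 0" by simp
    then obtain h' a where h': "(T ^^ Suc N) h' = fst p"
      and a: "dist (a *\<^sub>C h') (v j) < inverse (real (Suc j))"
      using root_vector_lift_approx[OF T surj N] by blast
    have "P (Suc j) (h', snd p + Suc N)" using p by (simp add: P_def)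
    moreover have "Q j p (h', snd p + Suc N)"
      unfolding Q_def using h' a by (auto simp del: funpow.simps)
    ultimately show "\<exists>q. P (Suc j) q \<and> Q j p q" by blast
  qed
  then obtain s where s: "\<forall>j. P j (s j) \<and> Q j (s j) (s (Suc j))" by (rule exE)
  define h m where "h j = fst (s j)" and "m j = snd (s j)" for j
  have ge: "j \<le> m j" and h0: "h 0 = e0" and m0: "m 0 = 0" for j
    using s[rule_format, of j] s[rule_format, of 0] by (simp_all add: h_def m_def P_def)
  have less: "m j < m (Suc j)" and step: "(T ^^ (m (Suc j) - m j)) (h (Suc j)) = h j"
    and close: "\<exists>a. dist (a *\<^sub>C h (Suc j)) (v j) < inverse (real (Suc j))" for j
    using s[rule_format, of j] by (simp_all add: h_def m_def Q_def)
  have mono: "m i \<le> m j" if "i \<le> j" for i j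
    by (rule lift_Suc_mono_le[where f = m, OF less_imp_le[OF less] that])
  have back_to: "(T ^^ (m (i + d) - m i)) (h (i + d)) = h i" for i d
  proof (induction d)
    case (Suc d)
    have "m (i + Suc d) - m i = (m (i + d) - m i) + (m (Suc (i + d)) - m (i + d))"
      using mono[of i "i + d"] mono[of "i + d" "Suc (i + d)"] by simp
    then show ?case
      using Suc step[of "i + d"] by (simp add: funpow_add)
  qed simp
  \<comment> \<open>by \<open>back_to\<close>, any \<open>j\<close> with \<open>m j \<ge> k\<close> in place of \<open>k\<close> gives the same vector\<close>
  define f where "f k = (T ^^ (m k - k)) (h k)" for k
  have fm: "f (m j) = h j" for j
    using back_to[of j "m j - j"] ge[of j] by (simp add: f_def)
  have "T (f (Suc k)) = f k" for k
  proof -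
    have "T (f (Suc k)) = (T ^^ Suc (m (Suc k) - Suc k)) (h (Suc k))"
      by (simp add: f_def)
    also have "Suc (m (Suc k) - Suc k) = (m k - k) + (m (Suc k) - m k)"
      using ge[of k] ge[of "Suc k"] mono[of k "Suc k"] by simp
    also have "(T ^^ \<dots>) (h (Suc k)) = f k"
      using back_to[of k 1] by (simp add: f_def funpow_add)
    finally show ?thesis .
  qed
  moreover have "f 0 = e0" using fm[of 0] by (simp add: m0 h0)
  moreover have "\<exists>k a. dist (a *\<^sub>C f k) (v j) < inverse (real (Suc j))" for j
    using close[of j] fm[of "Suc j"] by metis
  ultimately show ?thesis using that by blast
qed

text \<open>A dense sequence of the whole space may miss \<open>K\<close>, so its terms are replaced
  by nearby points of \<open>K\<close>, one for each accuracy. The index \<open>j\<close> has to be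
  large as well, because the chain will approximate \<open>v j\<close> only up to
  \<open>inverse (real (Suc j))\<close>.\<close>

lemma separable_sequence_near_subset:
  fixes K :: "'a::metric_space set"
  assumes "separable_space (euclidean :: 'a topology)" "K \<noteq> {}"
  obtains v where "\<And>j. v j \<in> K"
    "\<And>x e. x \<in> K \<Longrightarrow> e > 0 \<Longrightarrow> \<exists>j. dist (v j) x < e \<and> inverse (real (Suc j)) < e"
proof -
  obtain C :: "'a set" where C: "countable C" "closure C = UNIV"
    using assms(1) unfolding separable_space_def by auto
  then have "C \<noteq> {}" by auto
  define P where "P i n y \<longleftrightarrow> y \<in> K \<and> dist (from_nat_into C i) y < inverse (real (Suc n))" for i n y
  \<comment> \<open>Where no point of \<open>K\<close> is close enough, an arbitrary element of
    \<open>K\<close> is the default.\<close>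
  have "\<exists>y\<in>K. (\<exists>y. P i n y) \<longrightarrow> P i n y" for i n
    using assms(2) unfolding P_def by blast
  then obtain y where y: "y i n \<in> K" "\<And>z. P i n z \<Longrightarrow> P i n (y i n)" for i n
    by metis
  define v where "v j = (case prod_decode j of (i, n) \<Rightarrow> y i n)" for j
  have "\<exists>j. dist (v j) x < e \<and> inverse (real (Suc j)) < e" if x: "x \<in> K" and e: "e > 0" for x e
  proof -
    obtain n where n: "inverse (real (Suc n)) < e / 2"
      using reals_Archimedean[of "e / 2"] e by auto
    have "x \<in> closure C" using C(2) by simp
    then obtain c where c: "c \<in> C" "dist c x < inverse (real (Suc n))"
      unfolding closure_approachable by (metis inverse_positive_iff_positive of_nat_0_less_iff zero_less_Suc)
    obtain i where i: "c = from_nat_into C i"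
      using from_nat_into_surj[OF C(1) c(1)] by metis
    have "P i n x" using x c(2) by (simp add: P_def i)
    then have "dist c (y i n) < inverse (real (Suc n))" using y(2) by (auto simp: P_def i)
    then have "dist (y i n) x < e"
      using c(2) n dist_triangle3[of "y i n" x c] by linarith
    \<comment> \<open>The code of a pair is at least its second component, so a fine accuracy forces
      a large index.\<close>
    moreover have "inverse (real (Suc (prod_encode (i, n)))) \<le> inverse (real (Suc n))"
      using le_prod_encode_2[of n i] by (simp add: le_imp_inverse_le)
    then have "inverse (real (Suc (prod_encode (i, n)))) < e"
      using n e by linarith
    ultimately show ?thesis
      by (intro exI[of _ "prod_encode (i, n)"]) (simp add: v_def)
  qed
  moreover have "v j \<in> K" for j using y(1) by (simp add: v_def split_beta)
  ultimately show ?thesis using that by blast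
qed

text \<open>The vectors orthogonal to \<open>x\<close> form a closed set that is stable under
  scalars.\<close>

lemma orthogonal_approximable:
  fixes x v :: "'a::complex_hilbert"
  assumes "\<And>k. cinner x (f k) = 0"
    and "\<And>e. e > 0 \<Longrightarrow> \<exists>k a. dist (a *\<^sub>C f k) v < e"
  shows "cinner x v = 0"
proof -
  let ?S = "{y. cinner x y = 0}"
  have "v \<in> closure ?S"
    unfolding closure_approachable
  proof clarify
    fix e :: real assume "e > 0"
    then obtain k a where "dist (a *\<^sub>C f k) v < e" using assms(2) by blast
    moreover have "a *\<^sub>C f k \<in> ?S" by (simp add: cinner_scaleC_right assms(1))
    ultimately show "\<exists>y\<in>?S. dist y v < e" by blast
  qed
  moreover have "closed ?S" by (intro closed_Collect_eq continuous_intros)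
  ultimately show ?thesis by simp
qed

text \<open>
  The generating series of \<open>f\<close> is multiplied by the formal inverse of its pairing with \<open>f 0\<close>;
  no convergence is needed since every coefficient of the product is a finite sum.
\<close>

lemma backward_chain_normalise:
  fixes T :: "'a::complex_hilbert \<Rightarrow> 'a" and f :: "nat \<Rightarrow> 'a"
  assumes T: "bounded_clinear T" and zero: "T (f 0) = 0" and step: "\<And>k. T (f (Suc k)) = f k"
    and f0: "f 0 \<noteq> 0"
  obtains f' g where "T (f' 0) = 0" "\<And>k. T (f' (Suc k)) = f' k"
    "\<And>k. cinner (f' k) g = (if k = 0 then 1 else 0)"
    "\<And>x k. \<forall>k. cinner (f' k) x = 0 \<Longrightarrow> cinner (f k) x = 0"
proof -
  define F where "F x = Abs_fps (\<lambda>k. cinner (f k) x)" for x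
  define c where "c = inverse (F (f 0))"
  define f' where "f' k = (\<Sum>i=0..k. fps_nth c i *\<^sub>C f (k - i))" for k
  have F0: "fps_nth (F (f 0)) 0 \<noteq> 0"
    using f0 by (simp add: F_def cinner_eq_zero_self)
  have inner: "cinner (f' k) x = fps_nth (c * F x) k" for k x
    by (simp add: f'_def F_def fps_mult_nth cinner_sum_left cinner_scaleC_left)
  have T_sum: "T (sum u A) = (\<Sum>i\<in>A. T (u i))" for u :: "nat \<Rightarrow> 'a" and A
    using bounded_linear.linear[OF bounded_clinearD(1)[OF T]] by (rule linear_sum)
  have "T (f' 0) = 0"
    by (simp add: f'_def bounded_clinearD(2)[OF T] zero)
  moreover have "T (f' (Suc k)) = f' k" for k
  proof -
    have "T (f' (Suc k)) = (\<Sum>i=0..Suc k. fps_nth c i *\<^sub>C T (f (Suc k - i)))"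
      by (simp add: f'_def T_sum bounded_clinearD(2,3)[OF T])
    also have "\<dots> = (\<Sum>i=0..k. fps_nth c i *\<^sub>C f (k - i))"
      \<comment> \<open>The summand \<open>i = Suc k\<close> vanishes because
        \<open>T (f 0) = 0\<close>.\<close>
      by (simp add: zero Suc_diff_le step)
    finally show ?thesis by (simp add: f'_def)
  qed
  \<comment> \<open>The vector \<open>g\<close> is \<open>f 0\<close> itself, since \<open>c\<close>
    is the inverse of \<open>F (f 0)\<close>.\<close>
  moreover have "cinner (f' k) (f 0) = (if k = 0 then 1 else 0)" for k
    unfolding inner c_def inverse_mult_eq_1[OF F0] by simp
  \<comment> \<open>Formal power series over the complex numbers have no zero divisors, so the
    nonzero factor \<open>c\<close> cancels.\<close>
  moreover have "cinner (f k) x = 0" if "\<forall>k. cinner (f' k) x = 0" for x k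
  proof -
    have "c * F x = 0" using that by (intro fps_ext) (simp add: inner)
    moreover have "c \<noteq> 0" using F0 by (auto simp: c_def)
    ultimately have "F x = 0" by simp
    then have "fps_nth (F x) k = 0" by simp
    then show ?thesis by (simp add: F_def)
  qed
  ultimately show ?thesis using that by blast
qed

text \<open>Each \<open>S\<close> moves across the inner product as a \<open>T\<close>, which lowers
  the index of \<open>f\<close> by one or kills \<open>f 0\<close>.\<close>

lemma backward_chain_biorthogonal:
  fixes T S :: "'a::complex_hilbert \<Rightarrow> 'a"
  assumes adj: "\<And>x y. cinner (T x) y = cinner x (S y)"
    and zero: "T (f 0) = 0" and step: "\<And>k. T (f (Suc k)) = f k"
    and g: "\<And>k. cinner (f k) g = (if k = 0 then 1 else 0)"
  shows "cinner ((S ^^ i) g) (f j) = (if i = j then 1 else 0)"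
proof -
  have "cinner (f j) ((S ^^ i) g) = (if i = j then 1 else 0)"
  proof (induction i arbitrary: j)
    case 0
    then show ?case by (auto simp: g)
  next
    case (Suc i)
    show ?case
      by (cases j) (simp_all add: zero step Suc flip: adj)
  qed
  then show ?thesis
    by (subst cinner_commute) simp
qed

section \<open>Operators in the Cowen-Douglas class\<close>

lemma orthogonal_dense_span:
  assumes "closure (cspan A) = UNIV" "\<And>v. v \<in> A \<Longrightarrow> cinner x v = 0"
  shows "x = (0::'a::complex_hilbert)"
proof -
  let ?S = "{y. cinner x y = 0}"
  have "complex_vector.subspace ?S"
    by (auto simp: complex_vector.subspace_def cinner_add_right cinner_scaleC_right)
  then have "cspan A \<subseteq> ?S"
    using assms(2) by (intro complex_vector.span_minimal) auto
  moreover have "closed ?S" by (intro closed_Collect_eq continuous_intros)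
  ultimately have "UNIV \<subseteq> ?S" using assms(1) closure_minimal by metis
  then show ?thesis using cinner_eq_zero_self by blast
qed

lemma bounded_clinear_shifted:
  assumes "bounded_clinear T"
  shows "bounded_clinear (shifted T z)"
proof -
  have "bounded_linear (\<lambda>x. z *\<^sub>C x :: 'a)"
    by (rule bounded_linear_intro[where K = "cmod z"])
      (simp_all add: scaleC_add_right scaleR_eq_scaleC mult.commute norm_scaleC)
  then have "bounded_linear (shifted T z)"
    unfolding shifted_def using bounded_clinearD(1)[OF assms] by (rule bounded_linear_sub[rotated])
  then show ?thesis
    by (simp add: bounded_clinear_def shifted_def bounded_clinearD(2)[OF assms]
        complex_vector.scale_right_diff_distrib mult.commute)
qed

text \<open>Such an \<open>x\<close> lies in \<open>M\<close>, hence has the form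
  \<open>(S - cnj z) u\<close> for every \<open>z\<close> in \<Omega>. Its pairing with an
  eigenvector \<open>v\<close> of \<open>T\<close> at \<open>z\<close> is that of \<open>u\<close>
  with \<open>(T - z) v = 0\<close>, and these eigenvectors span a dense subspace.\<close>

lemma cowen_douglas_root_kernels_total:
  fixes T :: "'a::complex_hilbert \<Rightarrow> 'a"
  assumes "T \<in> cowen_douglas n \<Omega>" "connected \<Omega>" "0 \<in> \<Omega>"
    and x: "\<And>k v. (T ^^ k) v = 0 \<Longrightarrow> cinner x v = 0"
  shows "x = 0"
proof -
  let ?S = "cadjoint T"
  have T: "bounded_clinear T" and surj: "\<And>z. z \<in> \<Omega> \<Longrightarrow> range (shifted T z) = UNIV"
    and dense: "closure (cspan (\<Union>z\<in>\<Omega>. kernel (shifted T z))) = UNIV"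
    using assms(1) by (auto simp: cowen_douglas_def)
  have S: "bounded_clinear ?S" by (rule bounded_clinear_cadjoint[OF T])
  have shift0: "shifted R 0 = R" for R :: "'a \<Rightarrow> 'a" by (simp add: shifted_def)
  have surjT: "range T = UNIV" using surj[OF assms(3)] by (simp add: shift0)
  have adj: "cinner (shifted T z u) y = cinner u (shifted ?S (cnj z) y)" for z u y
    by (simp add: shifted_def cinner_diff_left cinner_diff_right cinner_scaleC_left
        cinner_scaleC_right cadjoint[OF T])
  define M where "M = {x. \<forall>k v. (T ^^ k) v = 0 \<longrightarrow> cinner x v = 0}"
  have M: "closed_csubspace M" "?S ` M = M"
    unfolding M_def by (rule orthogonal_root_kernels_invariant[OF T surjT S cadjoint[OF T]])+
  \<comment> \<open>The adjoint of \<open>T - z\<close> is \<open>?S - cnj z\<close>, so the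
    parameter runs through the conjugate of \<Omega>.\<close>
  have "connected (cnj ` \<Omega>)"
    by (intro connected_continuous_image continuous_intros assms(2))
  moreover have "\<exists>c>0. \<forall>y. c * norm y \<le> norm (shifted ?S w y)" if w: "w \<in> cnj ` \<Omega>" for w
  proof -
    obtain z where z: "z \<in> \<Omega>" "w = cnj z" using w by blast
    show ?thesis
      using adjoint_bounded_below[OF surj[OF z(1)] bounded_clinear_shifted[OF S] adj] z(2) by metis
  qed
  moreover have "0 \<in> cnj ` \<Omega>" using assms(3) by force
  moreover have "shifted ?S 0 ` M = M" using M(2) by (simp add: shift0)
  ultimately have image: "shifted ?S (cnj z) ` M = M" if "z \<in> \<Omega>" for z
    using shifted_image_connected[OF M(1) S] that by blast
  have "cinner x v = 0" if v: "v \<in> (\<Union>z\<in>\<Omega>. kernel (shifted T z))" for v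
  proof -
    obtain z where z: "z \<in> \<Omega>" "shifted T z v = 0" using v by (auto simp: kernel_def)
    have "x \<in> M" using x by (simp add: M_def)
    then obtain u where "x = shifted ?S (cnj z) u" using image[OF z(1)] by blast
    then have "cinner v x = 0" using adj[of z v u] z(2) by simp
    then show ?thesis using cinner_eq_zero_commute by blast
  qed
  then show ?thesis by (rule orthogonal_dense_span[OF dense])
qed

theorem theorem1p2:
  fixes T :: "'a::complex_hilbert \<Rightarrow> 'a" and \<Omega> :: "complex set" and n :: nat
  assumes separable: "separable_space (euclidean :: 'a topology)"
    and infinite_dim: "\<nexists>B :: 'a set. finite B \<and> cspan B = UNIV"
    and "n > 0"
    and "open \<Omega>" and "connected \<Omega>" and "0 \<in> \<Omega>"
    and "T \<in> cowen_douglas n \<Omega>"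
  shows "\<exists>g. generalized_basis g \<and> forward_shift_on (cadjoint T) g"
proof -
  have T: "bounded_clinear T" and "range (shifted T 0) = UNIV"
    and dim: "cdim (kernel (shifted T 0)) = n"
    using assms(6,7) by (auto simp: cowen_douglas_def)
  then have surj: "range T = UNIV" by (simp add: shifted_def)
  \<comment> \<open>A trivial kernel would have dimension 0, contrary to
    \<open>n > 0\<close>.\<close>
  obtain e0 where e0: "T e0 = 0" "e0 \<noteq> 0"
  proof (rule ccontr)
    assume "\<not> thesis"
    then have "kernel (shifted T 0) \<subseteq> cspan {}"
      using that by (auto simp: kernel_def shifted_def complex_vector.span_empty)
    then have "cdim (kernel (shifted T 0)) \<le> card ({} :: 'a set)"
      by (intro complex_vector.dim_le_card) auto
    then show False using dim \<open>n > 0\<close> by simp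
  qed
  \<comment> \<open>Only 0 is orthogonal to \<open>K\<close>, so a chain whose multiples approximate
    every element of \<open>K\<close> is total.\<close>
  define K where "K = {v. \<exists>N. (T ^^ N) v = 0}"
  have "K \<noteq> {}" using bounded_clinear_funpow(3)[OF T] by (auto simp: K_def)
  then obtain v where vK: "\<And>j. v j \<in> K"
    and near: "\<And>x e. x \<in> K \<Longrightarrow> e > 0 \<Longrightarrow> \<exists>j. dist (v j) x < e \<and> inverse (real (Suc j)) < e"
    using separable_sequence_near_subset[OF separable] by metis
  have "\<exists>N. (T ^^ N) (v j) = 0" for j using vK[of j] by (simp add: K_def)
  then obtain f where f: "f 0 = e0" "\<And>k. T (f (Suc k)) = f k"
    and approx: "\<And>j. \<exists>k a. dist (a *\<^sub>C f k) (v j) < inverse (real (Suc j))"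
    using backward_chain_approximating[OF T surj, of v e0] by metis
  have total: "x = 0" if x: "\<And>k. cinner x (f k) = 0" for x
  proof (rule cowen_douglas_root_kernels_total[OF assms(7,5,6)])
    fix N u assume "(T ^^ N) u = 0"
    then have "u \<in> K" by (auto simp: K_def)
    show "cinner x u = 0"
    proof (rule orthogonal_approximable[OF x])
      fix e :: real assume "e > 0"
      \<comment> \<open>One half of \<open>e\<close> is for the distance from \<open>v j\<close> to
        \<open>u\<close>, the other for the error of the chain at \<open>v j\<close>.\<close>
      then obtain j where j: "dist (v j) u < e / 2" "inverse (real (Suc j)) < e / 2"
        using near[OF \<open>u \<in> K\<close>, of "e / 2"] by auto
      obtain k a where "dist (a *\<^sub>C f k) (v j) < inverse (real (Suc j))" using approx by blast
      then have "dist (a *\<^sub>C f k) u < e"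
        using j dist_triangle[of "a *\<^sub>C f k" u "v j"] by linarith
      then show "\<exists>k a. dist (a *\<^sub>C f k) u < e" by blast
    qed
  qed
  have f0: "T (f 0) = 0" "f 0 \<noteq> 0" using e0 f(1) by simp_all
  obtain f' g where f': "T (f' 0) = 0" "\<And>k. T (f' (Suc k)) = f' k"
    and g: "\<And>k. cinner (f' k) g = (if k = 0 then 1 else 0)"
    and total': "\<And>x k. \<forall>k. cinner (f' k) x = 0 \<Longrightarrow> cinner (f k) x = 0"
    by (rule backward_chain_normalise[of T f, OF T f0(1) f(2) f0(2)]) blast
  have "x = 0" if "\<forall>k. cinner x (f' k) = 0" for x
    using total total'[of x] that cinner_eq_zero_commute by metis
  then have "total_sequence f'" by (auto simp: total_sequence_def)
  moreover have "cinner ((cadjoint T ^^ i) g) (f' j) = (if i = j then 1 else 0)" for i j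
    by (rule backward_chain_biorthogonal[OF cadjoint[OF T] f' g])
  ultimately have "generalized_basis (\<lambda>k. (cadjoint T ^^ k) g)"
    unfolding generalized_basis_def by blast
  then show ?thesis
    using bounded_clinear_cadjoint[OF T]
    by (intro exI[of _ "\<lambda>k. (cadjoint T ^^ k) g"]) (simp add: forward_shift_on_def)
qed

end
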